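(* Let $f$ be an expansive homeomorphism with canonical coordinates of a Peano continuum $M$ (a compact, connected, locally connected metric space). If $\mathrm{d}$ is a self-similar metric for $f$ and the holonomies are isometries with respect to $\mathrm{d}$, then $f$ is transitive.
   Context: Self-similar metric: a metric $\mathrm{d}$ compatible with the topology of $M$ for which there are an expansive constant $\eta>0$ and an expanding factor $\lambda>1$ such that $\mathrm{d}(p,q)\le\eta$ implies $\max\{\mathrm{d}(f(p),f(q)),\mathrm{d}(f^{-1}(p),f^{-1}(q))\}=\lambda\,\mathrm{d}(p,q)$. Local stable/unstable sets: $W^s_\epsilon(x)=\{y:\mathrm{d}(f^n(x),f^n(y))\le\epsilon\ \forall n\ge0\}$ and $W^u_\epsilon(x)=\{y:\mathrm{d}(f^{-n}(x),f^{-n}(y))\le\epsilon\ \forall n\ge0\}$. Canonical coordinates: for each $\epsilon>0$ there is $\delta>0$ such that $\mathrm{d}(x,y)<\delta$ implies $W^s_\epsilon(x)\cap W^u_\epsilon(y)\ne\emptyset$. If $2\epsilon$ is an expansive constant this intersection is a single point, denoted $[x,y]$. Product boxes, plaques and holonomy: for $q\in M$ and $r>0$ small enough that the brackets between points of the box are defined, the product box around $q$ is $C_r(q)=\{[y,x]:x\in W^s_r(q),\,y\in W^u_r(q)\}$. Its unstable plaques are the sets $\{[y,x]:y\in W^u_r(q)\}$ with $x\in W^s_r(q)$ fixed, and its stable plaques are the sets $\{[y,x]:x\in W^s_r(q)\}$ with $y\in W^u_r(q)$ fixed. The holonomy between two unstable plaques $P_1,P_2$ of the same box is the map $P_1\to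 P_2$ sending each point to the unique point of $P_2$ in the same stable plaque; holonomies between stable plaques are defined symmetrically. "Holonomies are isometries" means that all such maps (for all product boxes) preserve $\mathrm{d}$. *)

theory Defs
  imports "HOL-Analysis.Analysis"
begin

text \<open>
  The space \<open>M\<close> is the universe of a type of class \<open>metric_space\<close>. Dynamical notions take the
  metric as an explicit argument \<open>d\<close>, so that they can be used both for the given metric \<open>dist\<close> of
  \<open>M\<close> and for another compatible metric. The inverse of a homeomorphism \<open>f\<close> is \<open>inv f\<close>.
\<close>

definition iterate_int :: "('a \<Rightarrow> 'a) \<Rightarrow> int \<Rightarrow> 'a \<Rightarrow> 'a" where
  "iterate_int f n = (if n \<ge> 0 then f ^^ nat n else inv f ^^ nat (- n))"

definition peano_continuum :: "'a::metric_space set \<Rightarrow> bool" where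
  "peano_continuum S \<longleftrightarrow> compact S \<and> connected S \<and> locally connected S"

definition compatible_metric :: "('a::metric_space \<Rightarrow> 'a \<Rightarrow> real) \<Rightarrow> bool" where
  "compatible_metric d \<longleftrightarrow>
     Metric_space UNIV d \<and> Metric_space.mtopology UNIV d = (euclidean :: 'a topology)"

definition expansive_constant :: "('a \<Rightarrow> 'a) \<Rightarrow> ('a \<Rightarrow> 'a \<Rightarrow> real) \<Rightarrow> real \<Rightarrow> bool" where
  "expansive_constant f d c \<longleftrightarrow>
     c > 0 \<and> (\<forall>x y. (\<forall>n. d (iterate_int f n x) (iterate_int f n y) \<le> c) \<longrightarrow> x = y)"

definition expansive :: "('a \<Rightarrow> 'a) \<Rightarrow> ('a \<Rightarrow> 'a \<Rightarrow> real) \<Rightarrow> bool" where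
  "expansive f d \<longleftrightarrow> (\<exists>c. expansive_constant f d c)"

definition self_similar_metric :: "('a::metric_space \<Rightarrow> 'a) \<Rightarrow> ('a \<Rightarrow> 'a \<Rightarrow> real) \<Rightarrow> bool" where
  "self_similar_metric f d \<longleftrightarrow>
     compatible_metric d \<and>
     (\<exists>\<eta> \<kappa>. expansive_constant f d \<eta> \<and> \<kappa> > 1 \<and>
        (\<forall>p q. d p q \<le> \<eta> \<longrightarrow> max (d (f p) (f q)) (d (inv f p) (inv f q)) = \<kappa> * d p q))"

definition local_stable :: "('a \<Rightarrow> 'a) \<Rightarrow> ('a \<Rightarrow> 'a \<Rightarrow> real) \<Rightarrow> real \<Rightarrow> 'a \<Rightarrow> 'a set" where
  "local_stable f d \<epsilon> x = {y. \<forall>n::nat. d ((f ^^ n) x) ((f ^^ n) y) \<le> \<epsilon>}"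

definition local_unstable :: "('a \<Rightarrow> 'a) \<Rightarrow> ('a \<Rightarrow> 'a \<Rightarrow> real) \<Rightarrow> real \<Rightarrow> 'a \<Rightarrow> 'a set" where
  "local_unstable f d \<epsilon> x = {y. \<forall>n::nat. d ((inv f ^^ n) x) ((inv f ^^ n) y) \<le> \<epsilon>}"

definition canonical_coordinates :: "('a \<Rightarrow> 'a) \<Rightarrow> ('a \<Rightarrow> 'a \<Rightarrow> real) \<Rightarrow> bool" where
  "canonical_coordinates f d \<longleftrightarrow>
     (\<forall>\<epsilon>>0. \<exists>\<delta>>0. \<forall>x y. d x y < \<delta> \<longrightarrow> local_stable f d \<epsilon> x \<inter> local_unstable f d \<epsilon> y \<noteq> {})"

text \<open>
  The bracket \<open>[x, y]\<close> is taken at a fixed scale \<open>\<epsilon>\<close>, always used with \<open>2 * \<epsilon>\<close> an expansive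
  constant for \<open>d\<close>; the intersection then has at most one point, and \<open>bracket_defined\<close> says that
  it has one.
\<close>

definition bracket_defined ::
    "('a \<Rightarrow> 'a) \<Rightarrow> ('a \<Rightarrow> 'a \<Rightarrow> real) \<Rightarrow> real \<Rightarrow> 'a \<Rightarrow> 'a \<Rightarrow> bool" where
  "bracket_defined f d \<epsilon> x y \<longleftrightarrow> (\<exists>!z. z \<in> local_stable f d \<epsilon> x \<inter> local_unstable f d \<epsilon> y)"

definition bracket :: "('a \<Rightarrow> 'a) \<Rightarrow> ('a \<Rightarrow> 'a \<Rightarrow> real) \<Rightarrow> real \<Rightarrow> 'a \<Rightarrow> 'a \<Rightarrow> 'a" where
  "bracket f d \<epsilon> x y = (THE z. z \<in> local_stable f d \<epsilon> x \<inter> local_unstable f d \<epsilon> y)"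

definition product_box ::
    "('a \<Rightarrow> 'a) \<Rightarrow> ('a \<Rightarrow> 'a \<Rightarrow> real) \<Rightarrow> real \<Rightarrow> 'a \<Rightarrow> real \<Rightarrow> 'a set" where
  "product_box f d \<epsilon> q r =
     {bracket f d \<epsilon> y x | x y. x \<in> local_stable f d r q \<and> y \<in> local_unstable f d r q}"

text \<open>
  The condition that \<open>r\<close> is small enough. The first family of brackets is the one used to form
  the box. The bound \<open>r \<le> \<epsilon>\<close> makes \<open>[q, x] = x\<close> and \<open>[y, q] = y\<close>, so that the box
  contains the local stable and unstable sets spanning it, and ensures that a point of the box
  lies in exactly one stable and one unstable plaque.
\<close>

definition admissible_box ::
    "('a \<Rightarrow> 'a) \<Rightarrow> ('a \<Rightarrow> 'a \<Rightarrow> real) \<Rightarrow> real \<Rightarrow> 'a \<Rightarrow> real \<Rightarrow> bool" where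
  "admissible_box f d \<epsilon> q r \<longleftrightarrow>
     0 < r \<and> r \<le> \<epsilon> \<and>
     (\<forall>x\<in>local_stable f d r q. \<forall>y\<in>local_unstable f d r q. bracket_defined f d \<epsilon> y x) \<and>
     (\<forall>a\<in>product_box f d \<epsilon> q r. \<forall>b\<in>product_box f d \<epsilon> q r. bracket_defined f d \<epsilon> a b)"

definition unstable_plaques ::
    "('a \<Rightarrow> 'a) \<Rightarrow> ('a \<Rightarrow> 'a \<Rightarrow> real) \<Rightarrow> real \<Rightarrow> 'a \<Rightarrow> real \<Rightarrow> 'a set set" where
  "unstable_plaques f d \<epsilon> q r =
     {{bracket f d \<epsilon> y x | y. y \<in> local_unstable f d r q} | x. x \<in> local_stable f d r q}"

definition stable_plaques ::
    "('a \<Rightarrow> 'a) \<Rightarrow> ('a \<Rightarrow> 'a \<Rightarrow> real) \<Rightarrow> real \<Rightarrow> 'a \<Rightarrow> real \<Rightarrow> 'a set set" where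
  "stable_plaques f d \<epsilon> q r =
     {{bracket f d \<epsilon> y x | x. x \<in> local_stable f d r q} | y. y \<in> local_unstable f d r q}"

text \<open>
  Holonomy along a family \<open>\<T>\<close> of transverse plaques into the plaque \<open>P\<close>: for unstable plaques
  \<open>\<T>\<close> is the family of stable plaques of the box, and conversely.
\<close>

definition holonomy :: "'a set set \<Rightarrow> 'a set \<Rightarrow> 'a \<Rightarrow> 'a" where
  "holonomy \<T> P a = (THE b. b \<in> P \<and> (\<exists>T\<in>\<T>. a \<in> T \<and> b \<in> T))"

definition preserves_metric_on :: "('a \<Rightarrow> 'a \<Rightarrow> real) \<Rightarrow> 'a set \<Rightarrow> ('a \<Rightarrow> 'a) \<Rightarrow> bool" where
  "preserves_metric_on d P h \<longleftrightarrow> (\<forall>a\<in>P. \<forall>b\<in>P. d (h a) (h b) = d a b)"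

definition isometric_holonomies ::
    "('a \<Rightarrow> 'a) \<Rightarrow> ('a \<Rightarrow> 'a \<Rightarrow> real) \<Rightarrow> real \<Rightarrow> bool" where
  "isometric_holonomies f d \<epsilon> \<longleftrightarrow>
     (\<forall>q r. admissible_box f d \<epsilon> q r \<longrightarrow>
        (\<forall>P\<^sub>1\<in>unstable_plaques f d \<epsilon> q r. \<forall>P\<^sub>2\<in>unstable_plaques f d \<epsilon> q r.
           preserves_metric_on d P\<^sub>1 (holonomy (stable_plaques f d \<epsilon> q r) P\<^sub>2)) \<and>
        (\<forall>P\<^sub>1\<in>stable_plaques f d \<epsilon> q r. \<forall>P\<^sub>2\<in>stable_plaques f d \<epsilon> q r.
           preserves_metric_on d P\<^sub>1 (holonomy (unstable_plaques f d \<epsilon> q r) P\<^sub>2)))"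

definition topologically_transitive :: "('a::topological_space \<Rightarrow> 'a) \<Rightarrow> bool" where
  "topologically_transitive f \<longleftrightarrow>
     (\<forall>U V. open U \<and> U \<noteq> {} \<and> open V \<and> V \<noteq> {} \<longrightarrow> (\<exists>n::nat. (f ^^ n) ` U \<inter> V \<noteq> {}))"

end

theory Submission
  imports Defs
begin

text \<open>
  Write \<open>W\<^sup>s\<close> and \<open>W\<^sup>u\<close> for local stable and unstable sets. The expansion law of a self-similar
  metric forces \<open>f\<close> to contract distances along \<open>W\<^sup>s\<close> by exactly the factor \<open>\<kappa>\<close>, and \<open>f\<^sup>-\<^sup>1\<close> to do the
  same along \<open>W\<^sup>u\<close>.

  Fix \<open>x\<close> and let \<open>J\<close> be its prolongational limit set: the points approximated by \<open>f\<^sup>n u\<close> with \<open>u\<close>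
  arbitrarily close to \<open>x\<close> and \<open>n\<close> arbitrarily large. It suffices to show that \<open>J\<close> is the whole space.
  The set \<open>J\<close> is closed, nonempty, invariant, and saturated by unstable sets
  (\<open>prolongational_limit_saturated\<close>). Since the space is connected, the point is that such a set is
  open, and by canonical coordinates it is enough to absorb a little of the stable set of each of
  its points (\<open>saturated_closed_absorbs_neighbourhood\<close>).

  Let \<open>N c\<close> be the union of the stable sets of size \<open>c\<close> of the points of \<open>J\<close>. For small \<open>c\<close>,
  \<open>f\<^sup>n (N c) \<subseteq> N (c / \<kappa>\<^sup>n)\<close>. The isometric holonomies give more: moving a point of \<open>N c\<close>
  along its unstable set carries the stable segment that joins it to \<open>J\<close> to one of the same length,
  still ending in \<open>J\<close>. So, for all small \<open>c\<close>, \<open>N c\<close> is saturated by unstable sets of a size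
  independent of \<open>c\<close> (\<open>stable_neighbourhood_saturated\<close>), and a connected subset of an unstable set that
  meets \<open>N c\<close> lies in it; this persists after applying \<open>f\<^sup>n\<close>
  (\<open>funpow_connected_stays_in_saturated\<close>).

  Now let \<open>y\<close> be in \<open>N c\<close> for a small \<open>c\<close>, and let \<open>p\<close> be a limit of the backward orbit of \<open>y\<close>. Whenever
  \<open>f\<^sup>-\<^sup>n y\<close> is close to \<open>p\<close>, pick \<open>z\<close> in \<open>W\<^sup>s (f\<^sup>-\<^sup>n y) \<inter> W\<^sup>u p\<close>. Local connectedness joins \<open>z\<close> to \<open>p\<close> by a
  connected subset of \<open>W\<^sup>u p\<close> (\<open>small_unstable_connected\<close>), so \<open>f\<^sup>n z\<close> and \<open>f\<^sup>n p\<close> lie in the same sets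
  \<open>N c'\<close>. At one return time \<open>m\<close> the point \<open>f\<^sup>m z\<close> is stably close to \<open>y\<close>, which places \<open>f\<^sup>m p\<close> in some
  \<open>N r\<close>; hence \<open>f\<^sup>n p\<close> is in \<open>N (r / \<kappa>\<^bsup>n-m\<^esup>)\<close>, and at a later return time \<open>n\<close> so is \<open>f\<^sup>n z\<close> for the
  corresponding \<open>z\<close>. These points converge to \<open>y\<close> while their distance to \<open>J\<close> tends to \<open>0\<close>, so \<open>y\<close>
  belongs to \<open>J\<close>.
\<close>

section \<open>Compatible metrics on a compact space\<close>

lemma compatible_metric_Metric_space:
  assumes "compatible_metric d"
  shows "Metric_space UNIV d"
  using assms by (simp add: compatible_metric_def)

lemma open_iff_compatible_metric:
  fixes d :: "'a::metric_space \<Rightarrow> 'a \<Rightarrow> real"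
  assumes "compatible_metric d"
  shows "open U \<longleftrightarrow> (\<forall>x\<in>U. \<exists>r>0. \<forall>y. d x y < r \<longrightarrow> y \<in> U)"
proof -
  interpret Metric_space UNIV d
    using assms by (rule compatible_metric_Metric_space)
  have "mtopology = euclidean"
    using assms by (simp add: compatible_metric_def)
  then have "open U \<longleftrightarrow> openin mtopology U"
    by simp
  also have "\<dots> \<longleftrightarrow> (\<forall>x\<in>U. \<exists>r>0. \<forall>y. d x y < r \<longrightarrow> y \<in> U)"
    by (auto simp: openin_mtopology subset_iff)
  finally show ?thesis .
qed

lemma closed_iff_compatible_metric:
  fixes d :: "'a::metric_space \<Rightarrow> 'a \<Rightarrow> real"
  assumes "compatible_metric d"
  shows "closed S \<longleftrightarrow> (\<forall>x. (\<forall>r>0. \<exists>y\<in>S. d x y < r) \<longrightarrow> x \<in> S)"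
proof -
  have *: "x \<in> S \<or> (\<exists>r>0. \<forall>y. d x y < r \<longrightarrow> y \<in> - S) \<longleftrightarrow>
      ((\<forall>r>0. \<exists>y\<in>S. d x y < r) \<longrightarrow> x \<in> S)" for x
    by auto
  have "closed S \<longleftrightarrow> (\<forall>x. x \<in> S \<or> (\<exists>r>0. \<forall>y. d x y < r \<longrightarrow> y \<in> - S))"
    unfolding closed_def open_iff_compatible_metric[OF assms] Ball_def Compl_iff imp_conv_disj not_not ..
  then show ?thesis
    unfolding * .
qed

lemma open_ball_compatible_metric:
  fixes d :: "'a::metric_space \<Rightarrow> 'a \<Rightarrow> real"
  assumes d: "compatible_metric d"
  shows "open {y. d x y < e}"
  unfolding open_iff_compatible_metric[OF d]
proof
  interpret Metric_space UNIV d
    using d by (rule compatible_metric_Metric_space)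
  fix y assume y: "y \<in> {y. d x y < e}"
  have "d x z < e" if "d y z < e - d x y" for z
    using triangle[of x y z] that by simp
  then show "\<exists>r>0. \<forall>z. d y z < r \<longrightarrow> z \<in> {y. d x y < e}"
    using y by (intro exI[of _ "e - d x y"]) auto
qed

lemma continuous_on_compatible_metric:
  fixes d :: "'a::metric_space \<Rightarrow> 'a \<Rightarrow> real"
  assumes d: "compatible_metric d"
    and u: "continuous_on S u" and v: "continuous_on S v"
  shows "continuous_on S (\<lambda>z. d (u z) (v z))"
proof -
  interpret Metric_space UNIV d
    using d by (rule compatible_metric_Metric_space)
  have near: "\<forall>\<^sub>F z in at x within S. d (w x) (w z) < e"
    if w: "continuous_on S w" and x: "x \<in> S" and e: "e > 0" for w x e
  proof -
    have "open {y. d (w x) y < e}"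
      using d by (rule open_ball_compatible_metric)
    moreover have "w x \<in> {y. d (w x) y < e}"
      using e by simp
    ultimately show ?thesis
      using w x topological_tendstoD[of w "w x" "at x within S" "{y. d (w x) y < e}"]
      by (auto simp: continuous_on_def)
  qed
  show ?thesis
    unfolding continuous_on_def
  proof (intro ballI tendstoI)
    fix x and e :: real
    assume x: "x \<in> S" and e: "0 < e"
    have "\<forall>\<^sub>F z in at x within S. d (u x) (u z) < e/2"
      using near[OF u x half_gt_zero[OF e]] .
    moreover have "\<forall>\<^sub>F z in at x within S. d (v x) (v z) < e/2"
      using near[OF v x half_gt_zero[OF e]] .
    ultimately show "\<forall>\<^sub>F z in at x within S. dist (d (u z) (v z)) (d (u x) (v x)) < e"
    proof eventually_elim
      case (elim z)
      have "d (u z) (v z) \<le> d (u x) (u z) + d (u x) (v x) + d (v x) (v z)"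
        using triangle[of "u z" "u x" "v z"] triangle[of "u x" "v x" "v z"]
          commute[of "u x" "u z"] by simp
      moreover have "d (u x) (v x) \<le> d (u x) (u z) + d (u z) (v z) + d (v x) (v z)"
        using triangle[of "u x" "u z" "v x"] triangle[of "u z" "v z" "v x"]
          commute[of "v x" "v z"] by simp
      ultimately show ?case
        using elim by (simp add: dist_real_def)
    qed
  qed
qed

text \<open>
  Both metrics are continuous on the compact square, and \<open>d\<close> attains a positive minimum on the part
  of the square where \<open>d'\<close> is at least \<open>e\<close>.
\<close>
lemma compact_imp_metrics_uniformly_equivalent:
  fixes d d' :: "'a::metric_space \<Rightarrow> 'a \<Rightarrow> real"
  assumes compact: "compact (UNIV :: 'a set)"
    and d: "compatible_metric d" and d': "compatible_metric d'"
    and e: "e > 0"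
  shows "\<exists>\<delta>>0. \<forall>x y. d x y < \<delta> \<longrightarrow> d' x y < e"
proof -
  interpret D: Metric_space UNIV d
    using d by (rule compatible_metric_Metric_space)
  interpret D': Metric_space UNIV d'
    using d' by (rule compatible_metric_Metric_space)
  let ?K = "{z :: 'a \<times> 'a. e \<le> d' (fst z) (snd z)}"
  have "closed ?K"
    by (intro closed_Collect_le continuous_on_compatible_metric[OF d'] continuous_intros)
  moreover have "compact (UNIV :: ('a \<times> 'a) set)"
    using compact_Times[OF compact compact] by simp
  ultimately have K: "compact ?K"
    by (metis compact_Int_closed Int_UNIV_left)
  show ?thesis
  proof (cases "?K = {}")
    case True
    then show ?thesis
      by (intro exI[of _ 1]) (auto simp: not_le)
  next
    case False
    have "continuous_on ?K (\<lambda>z. d (fst z) (snd z))"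
      by (intro continuous_on_compatible_metric[OF d] continuous_intros)
    then obtain z where z: "z \<in> ?K" "\<forall>w\<in>?K. d (fst z) (snd z) \<le> d (fst w) (snd w)"
      using continuous_attains_inf[OF K False] by blast
    have "fst z \<noteq> snd z"
      using z(1) e by auto
    then have "0 < d (fst z) (snd z)"
      using D.nonneg[of "fst z" "snd z"] D.zero[OF UNIV_I UNIV_I] by (metis order_le_less)
    moreover have "d' x y < e" if "d x y < d (fst z) (snd z)" for x y
      using z(2)[rule_format, of "(x, y)"] that by force
    ultimately show ?thesis
      by (intro exI[of _ "d (fst z) (snd z)"] conjI allI impI)
  qed
qed

lemma compatible_metric_dist: "compatible_metric (dist :: 'a::metric_space \<Rightarrow> 'a \<Rightarrow> real)"
proof -
  have "Met_TC.mtopology = (euclidean :: 'a topology)"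
    by (simp add: topology_eq)
  then show ?thesis
    unfolding compatible_metric_def by (simp add: Met_TC.Metric_space_axioms)
qed

text \<open>
  Canonical coordinates are assumed for the given metric, whereas all estimates are made in the
  self-similar one.
\<close>
lemma canonical_coordinates_change_metric:
  fixes d d' :: "'a::metric_space \<Rightarrow> 'a \<Rightarrow> real"
  assumes compact: "compact (UNIV :: 'a set)"
    and d: "compatible_metric d" and d': "compatible_metric d'"
    and cc: "canonical_coordinates f d"
  shows "canonical_coordinates f d'"
  unfolding canonical_coordinates_def
proof (intro allI impI)
  fix \<epsilon> :: real assume "\<epsilon> > 0"
  from compact_imp_metrics_uniformly_equivalent[OF compact d d' this]
  obtain \<epsilon>' where \<epsilon>': "\<epsilon>' > 0" "\<And>x y. d x y < \<epsilon>' \<Longrightarrow> d' x y < \<epsilon>" by blast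
  have "\<epsilon>'/2 > 0" using \<epsilon>' by simp
  then obtain \<delta>' where \<delta>': "\<delta>' > 0"
    "\<And>x y. d x y < \<delta>' \<Longrightarrow> local_stable f d (\<epsilon>'/2) x \<inter> local_unstable f d (\<epsilon>'/2) y \<noteq> {}"
    using cc unfolding canonical_coordinates_def by blast
  from compact_imp_metrics_uniformly_equivalent[OF compact d' d \<delta>'(1)]
  obtain \<delta> where \<delta>: "\<delta> > 0" "\<And>x y. d' x y < \<delta> \<Longrightarrow> d x y < \<delta>'" by blast
  have le: "d' x y \<le> \<epsilon>" if "d x y \<le> \<epsilon>'/2" for x y
    using \<epsilon>'(2)[of x y] that \<epsilon>'(1) by simp
  have "local_stable f d' \<epsilon> x \<inter> local_unstable f d' \<epsilon> y \<noteq> {}" if "d' x y < \<delta>" for x y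
    using \<delta>'(2)[OF \<delta>(2)[OF that]] le
    unfolding local_stable_def local_unstable_def by blast
  then show "\<exists>\<delta>>0. \<forall>x y. d' x y < \<delta> \<longrightarrow>
      local_stable f d' \<epsilon> x \<inter> local_unstable f d' \<epsilon> y \<noteq> {}"
    using \<delta>(1) by blast
qed


section \<open>Exact contraction along local stable and unstable sets\<close>

text \<open>
  Once the sequence expands in one step, the recurrence forces it to expand by \<open>\<kappa>\<close> for ever,
  which boundedness forbids; so every step must realise the other term of the maximum.
\<close>
lemma bounded_max_recurrence_decays:
  fixes a :: "nat \<Rightarrow> real"
  assumes \<kappa>: "\<kappa> > 1" and nonneg: "\<And>n. 0 \<le> a n" and bounded: "\<And>n. a n \<le> \<eta>"
    and rec: "\<And>n. max (a (Suc (Suc n))) (a n) = \<kappa> * a (Suc n)"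
  shows "a n = a 0 / \<kappa> ^ n"
proof -
  have step: "a n = \<kappa> * a (Suc n)" for n
  proof (rule ccontr)
    assume ne: "a n \<noteq> \<kappa> * a (Suc n)"
    then have "a n < \<kappa> * a (Suc n)"
      using rec[of n] by (simp add: max_def split: if_splits)
    then have pos: "0 < a (Suc n)"
      using nonneg[of n] \<kappa> by (metis le_less_trans zero_less_mult_pos less_trans zero_less_one)
    have up: "a (Suc n) > 0 \<and> a (Suc (Suc n)) = \<kappa> * a (Suc n)"
      using pos ne rec[of n] by (simp add: max_def split: if_splits)
    have all: "a (Suc n + k) > 0 \<and> a (Suc (Suc n + k)) = \<kappa> * a (Suc n + k)" for k
    proof (induction k)
      case 0
      then show ?case using up by simp
    next
      case (Suc k)
      define b where "b = a (Suc n + k)"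
      have b: "b > 0" "a (Suc (Suc n + k)) = \<kappa> * b"
        using Suc by (auto simp: b_def)
      have "1 * b < (\<kappa> * \<kappa>) * b"
        using b(1) less_1_mult[OF \<kappa> \<kappa>] by (intro mult_strict_right_mono) auto
      then have "b < \<kappa> * (\<kappa> * b)"
        by (simp add: mult.assoc)
      then have "a (Suc (Suc (Suc n + k))) = \<kappa> * (\<kappa> * b)"
        using rec[of "Suc n + k"] b by (simp add: max_def b_def split: if_splits)
      then show ?case
        using b \<kappa> by simp
    qed
    have pow: "a (Suc n + k) = \<kappa> ^ k * a (Suc n)" for k
      by (induction k) (use all in auto)
    obtain k where "\<eta> / a (Suc n) < \<kappa> ^ k"
      using real_arch_pow[OF \<kappa>] by blast
    then have "\<eta> < a (Suc n + k)"
      unfolding pow using pos by (simp add: divide_less_eq)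
    then show False
      using bounded[of "Suc n + k"] by simp
  qed
  show ?thesis
  proof (induction n)
    case 0
    then show ?case by simp
  next
    case (Suc n)
    then show ?case
      using step[of n] \<kappa> by (simp add: field_simps)
  qed
qed

text \<open>
  Stated for a pair \<open>h\<close>, \<open>k\<close> so that it serves both \<open>f\<close> along stable sets and its inverse along
  unstable sets.
\<close>
lemma orbit_distance_decays:
  fixes d :: "'a \<Rightarrow> 'a \<Rightarrow> real"
  assumes \<kappa>: "\<kappa> > 1" and nonneg: "\<And>x y. 0 \<le> d x y"
    and inv: "\<And>x. k (h x) = x"
    and expand: "\<And>p q. d p q \<le> \<eta> \<Longrightarrow> max (d (h p) (h q)) (d (k p) (k q)) = \<kappa> * d p q"
    and close: "\<And>n. d ((h ^^ n) x) ((h ^^ n) y) \<le> \<eta>"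
  shows "d ((h ^^ n) x) ((h ^^ n) y) = d x y / \<kappa> ^ n"
proof -
  let ?a = "\<lambda>n. d ((h ^^ n) x) ((h ^^ n) y)"
  have "max (?a (Suc (Suc n))) (?a n) = \<kappa> * ?a (Suc n)" for n
    using expand[OF close[of "Suc n"]] by (simp add: inv)
  from bounded_max_recurrence_decays[of \<kappa> ?a, OF \<kappa> nonneg close this]
  show ?thesis by simp
qed


section \<open>Self-similar systems\<close>

locale self_similar_system =
  fixes f :: "'a::metric_space \<Rightarrow> 'a" and d :: "'a \<Rightarrow> 'a \<Rightarrow> real" and \<eta> \<kappa> :: real
  assumes compact_space: "compact (UNIV :: 'a set)"
    and homeo: "homeomorphism UNIV UNIV f (inv f)"
    and compatible: "compatible_metric d"
    and canonical: "canonical_coordinates f d"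
    and expansive_\<eta>: "expansive_constant f d \<eta>"
    and \<kappa>_gt_1: "\<kappa> > 1"
    and expand: "\<And>p q. d p q \<le> \<eta> \<Longrightarrow> max (d (f p) (f q)) (d (inv f p) (inv f q)) = \<kappa> * d p q"
begin

sublocale Metric_space UNIV d
  using compatible by (rule compatible_metric_Metric_space)

abbreviation Ws :: "real \<Rightarrow> 'a \<Rightarrow> 'a set" where "Ws \<equiv> local_stable f d"
abbreviation Wu :: "real \<Rightarrow> 'a \<Rightarrow> 'a set" where "Wu \<equiv> local_unstable f d"

lemma \<eta>_pos: "\<eta> > 0"
  using expansive_\<eta> by (simp add: expansive_constant_def)

lemma inv_f_f [simp]: "inv f (f x) = x" and f_inv_f [simp]: "f (inv f x) = x"
  using homeo by (auto simp: homeomorphism_def)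

lemma funpow_funpow: "(h ^^ m) ((h ^^ n) x) = (h ^^ (m + n)) x"
  by (simp add: funpow_add)

lemma pow_inv_pow: "j \<le> n \<Longrightarrow> (f ^^ j) ((inv f ^^ n) x) = (inv f ^^ (n - j)) x"
proof (induction j)
  case (Suc j)
  then have "n - j = Suc (n - Suc j)" by simp
  with Suc show ?case by simp
qed simp

lemma inv_pow_pow: "j \<le> n \<Longrightarrow> (inv f ^^ j) ((f ^^ n) x) = (f ^^ (n - j)) x"
proof (induction j)
  case (Suc j)
  then have "n - j = Suc (n - Suc j)" by simp
  with Suc show ?case by simp
qed simp

lemma inv_pow_pow_ge: "n \<le> j \<Longrightarrow> (inv f ^^ j) ((f ^^ n) x) = (inv f ^^ (j - n)) x"
  using inv_pow_pow[of n n x] funpow_add[of "j - n" n "inv f"] by simp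

lemma Ws_iff: "y \<in> Ws c x \<longleftrightarrow> (\<forall>n. d ((f ^^ n) x) ((f ^^ n) y) \<le> c)"
  by (simp add: local_stable_def)

lemma Wu_iff: "y \<in> Wu c x \<longleftrightarrow> (\<forall>n. d ((inv f ^^ n) x) ((inv f ^^ n) y) \<le> c)"
  by (simp add: local_unstable_def)

lemma Ws_sym: "y \<in> Ws c x \<longleftrightarrow> x \<in> Ws c y" and Wu_sym: "y \<in> Wu c x \<longleftrightarrow> x \<in> Wu c y"
  by (simp_all add: Ws_iff Wu_iff commute)

lemma Ws_mono: "y \<in> Ws c x \<Longrightarrow> c \<le> c' \<Longrightarrow> y \<in> Ws c' x"
  and Wu_mono: "y \<in> Wu c x \<Longrightarrow> c \<le> c' \<Longrightarrow> y \<in> Wu c' x"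
  unfolding Ws_iff Wu_iff by (meson order_trans)+

lemma Ws_trans: "y \<in> Ws b x \<Longrightarrow> z \<in> Ws c y \<Longrightarrow> z \<in> Ws (b + c) x"
  and Wu_trans: "y \<in> Wu b x \<Longrightarrow> z \<in> Wu c y \<Longrightarrow> z \<in> Wu (b + c) x"
  unfolding Ws_iff Wu_iff by (meson UNIV_I add_mono order_trans triangle)+

lemma Ws_dist: "y \<in> Ws c x \<Longrightarrow> d x y \<le> c" and Wu_dist: "y \<in> Wu c x \<Longrightarrow> d x y \<le> c"
  unfolding Ws_iff Wu_iff by (metis funpow_0)+

lemma Ws_refl: "0 \<le> c \<Longrightarrow> x \<in> Ws c x" and Wu_refl: "0 \<le> c \<Longrightarrow> x \<in> Wu c x"
  by (simp_all add: Ws_iff Wu_iff)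

lemma Ws_contracts: "y \<in> Ws \<eta> x \<Longrightarrow> d ((f ^^ n) x) ((f ^^ n) y) = d x y / \<kappa> ^ n"
  using orbit_distance_decays[of \<kappa> d "inv f" f \<eta> x y n] \<kappa>_gt_1 expand by (simp add: Ws_iff)

lemma Wu_contracts: "y \<in> Wu \<eta> x \<Longrightarrow> d ((inv f ^^ n) x) ((inv f ^^ n) y) = d x y / \<kappa> ^ n"
  using orbit_distance_decays[of \<kappa> d f "inv f" \<eta> x y n] \<kappa>_gt_1 expand
  by (simp add: Wu_iff max.commute)

lemma \<kappa>_pow_ge_1: "1 \<le> \<kappa> ^ n"
  using \<kappa>_gt_1 by (simp add: one_le_power)

lemma divide_\<kappa>_pow_le: "0 \<le> a \<Longrightarrow> a / \<kappa> ^ n \<le> a"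
  using \<kappa>_pow_ge_1[of n] by (simp add: divide_le_eq mult_le_cancel_left1 not_less)

text \<open>
  Staying \<open>\<eta>\<close>-close along the half orbit already gives exact contraction, so the size of the local
  set containing \<open>y\<close> is just the initial distance.
\<close>
lemma Ws_shrink: "y \<in> Ws \<eta> x \<Longrightarrow> d x y \<le> c \<Longrightarrow> y \<in> Ws c x"
  unfolding Ws_iff[of y c] using divide_\<kappa>_pow_le[of "d x y"]
  by (auto simp: Ws_contracts intro: order_trans)

lemma Wu_shrink: "y \<in> Wu \<eta> x \<Longrightarrow> d x y \<le> c \<Longrightarrow> y \<in> Wu c x"
  unfolding Wu_iff[of y c] using divide_\<kappa>_pow_le[of "d x y"]
  by (auto simp: Wu_contracts intro: order_trans)

lemma funpow_Ws:
  assumes "y \<in> Ws c x" "c \<le> \<eta>"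
  shows "(f ^^ n) y \<in> Ws (c / \<kappa> ^ n) ((f ^^ n) x)"
proof -
  have y: "y \<in> Ws \<eta> x"
    using assms by (rule Ws_mono)
  then have "(f ^^ n) y \<in> Ws \<eta> ((f ^^ n) x)"
    by (simp add: Ws_iff funpow_funpow)
  moreover have "d ((f ^^ n) x) ((f ^^ n) y) \<le> c / \<kappa> ^ n"
    using Ws_contracts[OF y] Ws_dist[OF assms(1)] \<kappa>_gt_1 by (simp add: divide_right_mono)
  ultimately show ?thesis
    by (rule Ws_shrink)
qed

lemma inv_funpow_Wu:
  assumes "y \<in> Wu c x" "c \<le> \<eta>"
  shows "(inv f ^^ n) y \<in> Wu (c / \<kappa> ^ n) ((inv f ^^ n) x)"
proof -
  have y: "y \<in> Wu \<eta> x"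
    using assms by (rule Wu_mono)
  then have "(inv f ^^ n) y \<in> Wu \<eta> ((inv f ^^ n) x)"
    by (simp add: Wu_iff funpow_funpow)
  moreover have "d ((inv f ^^ n) x) ((inv f ^^ n) y) \<le> c / \<kappa> ^ n"
    using Wu_contracts[OF y] Wu_dist[OF assms(1)] \<kappa>_gt_1 by (simp add: divide_right_mono)
  ultimately show ?thesis
    by (rule Wu_shrink)
qed

lemma eventually_small: "e > 0 \<Longrightarrow> \<exists>N. \<forall>n\<ge>N. c / \<kappa> ^ n < e"
proof -
  assume e: "e > 0"
  have "(\<lambda>n. c / \<kappa> ^ n) \<longlonglongrightarrow> 0"
    using \<kappa>_gt_1 LIMSEQ_divide_realpow_zero by blast
  from order_tendstoD(2)[OF this e] show ?thesis
    by (simp add: eventually_sequentially)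
qed

lemma expansive_unique:
  assumes "expansive_constant f d c"
    and "\<And>n. d ((f ^^ n) x) ((f ^^ n) y) \<le> c"
    and "\<And>n. d ((inv f ^^ n) x) ((inv f ^^ n) y) \<le> c"
  shows "x = y"
proof -
  have "d (iterate_int f n x) (iterate_int f n y) \<le> c" for n
    using assms(2)[of "nat n"] assms(3)[of "nat (- n)"] by (simp add: iterate_int_def)
  then show ?thesis
    using assms(1) unfolding expansive_constant_def by blast
qed

lemma Ws_Wu_unique:
  assumes "expansive_constant f d c" "y \<in> Ws c x" "y \<in> Wu c x"
  shows "x = y"
  using assms expansive_unique[of c x y] by (simp add: Ws_iff Wu_iff)

lemma local_product:
  assumes "e > 0"
  shows "\<exists>\<delta>>0. \<forall>x y. d x y < \<delta> \<longrightarrow> (\<exists>z. z \<in> Ws e x \<and> z \<in> Wu e y)"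
  using canonical assms unfolding canonical_coordinates_def by (simp add: ex_in_conv[symmetric])

lemma f_lipschitz: "d p q \<le> \<eta> \<Longrightarrow> d (f p) (f q) \<le> \<kappa> * d p q"
  using expand[of p q] by linarith

lemma inv_f_lipschitz: "d p q \<le> \<eta> \<Longrightarrow> d (inv f p) (inv f q) \<le> \<kappa> * d p q"
  using expand[of p q] by linarith

lemma exists_recurrent_limit:
  fixes s :: "nat \<Rightarrow> 'a"
  shows "\<exists>p. \<forall>e>0. \<forall>N. \<exists>n\<ge>N. d (s n) p < e"
proof -
  obtain p r where r: "strict_mono r" "(s \<circ> r) \<longlonglongrightarrow> p"
    using compact_space unfolding compact_def by (metis UNIV_I)
  have "\<exists>n\<ge>N. d (s n) p < e" if e: "e > 0" for e N
  proof -
    obtain \<delta> where \<delta>: "\<delta> > 0" "\<And>x y. dist x y < \<delta> \<Longrightarrow> d x y < e"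
      using compact_imp_metrics_uniformly_equivalent
          [OF compact_space compatible_metric_dist compatible e] by blast
    obtain M where "\<And>m. m \<ge> M \<Longrightarrow> dist (s (r m)) p < \<delta>"
      using metric_LIMSEQ_D[OF r(2) \<delta>(1)] by auto
    then have "d (s (r (max M N))) p < e"
      using \<delta>(2) by simp
    moreover have "N \<le> r (max M N)"
      using seq_suble[OF r(1), of "max M N"] by simp
    ultimately show ?thesis by blast
  qed
  then show ?thesis by blast
qed

lemma continuous_funpow: "continuous_on UNIV (f ^^ n)" "continuous_on UNIV (inv f ^^ n)"
proof -
  have *: "continuous_on UNIV f" "continuous_on UNIV (inv f)"
    using homeo by (auto simp: homeomorphism_def)
  have pow: "continuous_on UNIV (h ^^ n)" if "continuous_on UNIV h" for h :: "'a \<Rightarrow> 'a"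
  proof (induction n)
    case (Suc n)
    from continuous_on_compose2[OF that Suc] show ?case
      by (simp add: o_def)
  qed (simp add: id_def)
  show "continuous_on UNIV (f ^^ n)" "continuous_on UNIV (inv f ^^ n)"
    using pow * by blast+
qed


section \<open>Connected pieces of unstable sets\<close>

lemma closed_Ws_Wu_graph: "closed {z. snd z \<in> Ws c (fst z) \<and> snd z \<in> Wu c p}"
proof -
  have [continuous_intros]: "continuous_on S (\<lambda>z. (f ^^ n) (u z))"
      "continuous_on S (\<lambda>z. (inv f ^^ n) (u z))"
    if "continuous_on S u" for n S and u :: "'a \<times> 'a \<Rightarrow> 'a"
    using continuous_on_compose2[OF continuous_funpow(1) that, of n]
      continuous_on_compose2[OF continuous_funpow(2) that, of n] by auto
  show ?thesis
    unfolding Ws_iff Wu_iff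
    by (intro closed_Collect_conj closed_Collect_all closed_Collect_le
        continuous_on_compatible_metric[OF compatible] continuous_intros)
qed

text \<open>
  Locally project a neighbourhood of \<open>p\<close> to the unstable set of \<open>p\<close> along stable sets. The projection
  fixes the points of the unstable set near \<open>p\<close> and is continuous, so the image of a connected
  neighbourhood is a connected piece of the unstable set containing all of them.
\<close>
lemma small_unstable_connected:
  assumes lc: "locally connected (UNIV :: 'a set)" and c: "0 < c" "2 * c \<le> \<eta>"
  shows "\<exists>\<tau>>0. \<forall>z\<in>Wu \<tau> p. \<exists>C. connected C \<and> p \<in> C \<and> z \<in> C \<and> C \<subseteq> Wu c p"
proof -
  obtain \<delta> where \<delta>: "\<delta> > 0" "\<And>x y. d x y < \<delta> \<Longrightarrow> \<exists>z. z \<in> Ws c x \<and> z \<in> Wu c y"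
    using local_product[OF c(1)] by blast
  define B where "B = {x. d p x < \<delta>}"
  have "open B"
    unfolding B_def using compatible by (rule open_ball_compatible_metric)
  moreover have "p \<in> B"
    using \<delta> by (simp add: B_def)
  ultimately obtain V where V: "open V" "connected V" "p \<in> V" "V \<subseteq> B"
    using lc unfolding locally_connected by (metis open_openin subtopology_UNIV)
  define \<pi> where "\<pi> w = (SOME v. v \<in> Ws c w \<and> v \<in> Wu c p)" for w
  have \<pi>: "\<pi> w \<in> Ws c w" "\<pi> w \<in> Wu c p" if "w \<in> V" for w
  proof -
    have "d w p < \<delta>"
      using that V(4) by (auto simp: B_def commute)
    from someI_ex[OF \<delta>(2)[OF this]] show "\<pi> w \<in> Ws c w" "\<pi> w \<in> Wu c p"
      by (auto simp: \<pi>_def)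
  qed
  have unique: "v = v'" if "v \<in> Ws c w" "v \<in> Wu c p" "v' \<in> Ws c w" "v' \<in> Wu c p" for w v v'
  proof -
    have "v' \<in> Ws (c + c) v" "v' \<in> Wu (c + c) v"
      using that by (meson Ws_trans Wu_trans Ws_sym Wu_sym)+
    then have "v' \<in> Ws \<eta> v" "v' \<in> Wu \<eta> v"
      using c(2) by (auto intro: Ws_mono Wu_mono)
    then show ?thesis
      using Ws_Wu_unique[OF expansive_\<eta>] by blast
  qed
  \<comment> \<open>The graph of \<open>\<pi>\<close> is cut out by closed conditions, so preimages of closed sets are projections of compact sets.\<close>
  have "continuous_on V \<pi>"
    unfolding continuous_on_closed_invariant
  proof (intro allI impI)
    fix F :: "'a set" assume "closed F"
    define K where "K = {z. snd z \<in> Ws c (fst z) \<and> snd z \<in> Wu c p} \<inter> UNIV \<times> F"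
    have "closed K"
      unfolding K_def using \<open>closed F\<close> by (intro closed_Int closed_Ws_Wu_graph closed_Times closed_UNIV)
    moreover have "compact (UNIV :: ('a \<times> 'a) set)"
      using compact_Times[OF compact_space compact_space] by simp
    ultimately have "compact K"
      by (metis compact_Int_closed Int_UNIV_left)
    then have "closed (fst ` K)"
      by (intro compact_imp_closed compact_continuous_image continuous_intros)
    moreover have "fst ` K \<inter> V = \<pi> -` F \<inter> V"
    proof -
      have "\<pi> w = v" if "(w, v) \<in> K" "w \<in> V" for w v
        using that \<pi>[of w] unique[of "\<pi> w" w v] by (auto simp: K_def)
      moreover have "(w, \<pi> w) \<in> K" if "\<pi> w \<in> F" "w \<in> V" for w
        using that \<pi>[of w] by (auto simp: K_def)
      ultimately show ?thesis
        by (force simp: K_def)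
    qed
    ultimately show "\<exists>A. closed A \<and> A \<inter> V = \<pi> -` F \<inter> V"
      by blast
  qed
  then have conn: "connected (\<pi> ` V)"
    using V(2) by (rule connected_continuous_image)
  obtain r where r: "r > 0" "\<And>y. d p y < r \<Longrightarrow> y \<in> V"
    using V open_iff_compatible_metric[OF compatible, of V] by blast
  define \<tau> where "\<tau> = min c (r / 2)"
  have \<pi>_fixes: "z \<in> \<pi> ` V" if z: "z \<in> Wu \<tau> p" for z
  proof -
    have "z \<in> V"
      using Wu_dist[OF z] r by (simp add: \<tau>_def)
    moreover have "\<pi> z = z"
      using unique[of "\<pi> z" z z] \<pi>[OF \<open>z \<in> V\<close>] Ws_refl[of c z] Wu_mono[OF z, of c] c(1)
      by (simp add: \<tau>_def)
    ultimately show ?thesis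
      by force
  qed
  have "\<tau> > 0" using c r by (simp add: \<tau>_def)
  moreover have "p \<in> \<pi> ` V"
    using \<pi>_fixes[of p] Wu_refl[of \<tau> p] \<open>\<tau> > 0\<close> by simp
  ultimately show ?thesis
    using conn \<pi>_fixes \<pi>(2) by (intro exI[of _ \<tau>] conjI ballI exI[of _ "\<pi> ` V"]) auto
qed

lemma funpow_lipschitz:
  assumes "\<kappa> ^ n * d a b \<le> \<eta>" "i \<le> n"
  shows "d ((f ^^ i) a) ((f ^^ i) b) \<le> \<kappa> ^ i * d a b"
  using assms(2)
proof (induction i)
  case (Suc i)
  have "\<kappa> ^ i * d a b \<le> \<kappa> ^ n * d a b"
    using \<kappa>_gt_1 Suc by (intro mult_right_mono power_increasing) auto
  then have "d ((f ^^ i) a) ((f ^^ i) b) \<le> \<eta>"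
    using Suc assms(1) by simp
  from f_lipschitz[OF this] show ?case
    using Suc \<kappa>_gt_1 by simp (smt (verit) mult_left_mono mult.assoc)
qed simp

text \<open>
  For each fixed \<open>n\<close>, points of \<open>C\<close> that are close enough have images under \<open>f\<^sup>n\<close> in the same unstable
  set of size \<open>r\<close>: the iterates from \<open>f\<^sup>n\<close> back to the identity are Lipschitz at small scales, and the
  negative ones contract along \<open>C\<close>. Hence membership of \<open>f\<^sup>n a\<close> in \<open>S\<close> is locally constant in \<open>a \<in> C\<close>.
\<close>
lemma funpow_connected_stays_in_saturated:
  assumes C: "connected C" "C \<subseteq> Wu c p" "2 * c \<le> \<eta>"
    and r: "r > 0" and sat: "\<And>y y'. y \<in> S \<Longrightarrow> y' \<in> Wu r y \<Longrightarrow> y' \<in> S"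
    and ab: "a \<in> C" "b \<in> C" "(f ^^ n) a \<in> S"
  shows "(f ^^ n) b \<in> S"
proof (rule connected_induction_simple[where P = "\<lambda>x. (f ^^ n) x \<in> S", OF C(1) ab])
  fix a assume a: "a \<in> C"
  \<comment> \<open>The factor \<open>\<kappa>\<^sup>n\<close> is the worst expansion of the first \<open>n\<close> forward iterates.\<close>
  define \<delta> where "\<delta> = min r \<eta> / (\<kappa> ^ n)"
  have \<delta>: "\<delta> > 0"
    using r \<eta>_pos \<kappa>_gt_1 by (simp add: \<delta>_def)
  have close: "(f ^^ n) x \<in> Wu r ((f ^^ n) a)" if x: "x \<in> C" "d a x < \<delta>" for x
  proof -
    have small: "\<kappa> ^ n * d a x \<le> min r \<eta>"
      using x(2) \<kappa>_gt_1 by (simp add: \<delta>_def less_divide_eq mult.commute)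
    have "x \<in> Wu (c + c) a"
      using a x(1) C(2) by (meson Wu_sym Wu_trans subsetD)
    then have x\<eta>: "x \<in> Wu \<eta> a"
      using C(3) by (auto intro: Wu_mono)
    have le: "\<kappa> ^ i * d a x \<le> r" if "i \<le> n" for i
    proof -
      have "\<kappa> ^ i * d a x \<le> \<kappa> ^ n * d a x"
        using \<kappa>_gt_1 that by (intro mult_right_mono power_increasing) auto
      then show ?thesis using small by simp
    qed
    show ?thesis
      unfolding Wu_iff
    proof
      fix j
      show "d ((inv f ^^ j) ((f ^^ n) a)) ((inv f ^^ j) ((f ^^ n) x)) \<le> r"
      proof (cases "j \<le> n")
        case True
        then show ?thesis
          using funpow_lipschitz[of n a x "n - j"] le[of "n - j"] small
          by (simp add: inv_pow_pow)
      next
        case False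
        then show ?thesis
          using x\<eta> le[of 0] divide_\<kappa>_pow_le[of "d a x" "j - n"]
          by (simp add: inv_pow_pow_ge Wu_contracts)
      qed
    qed
  qed
  have iff: "(f ^^ n) x \<in> S \<longleftrightarrow> (f ^^ n) a \<in> S" if "x \<in> C" "d a x < \<delta>" for x
    using close[OF that] sat Wu_sym by blast
  define B where "B = {x. d a x < \<delta>}"
  have "open B"
    unfolding B_def using compatible by (rule open_ball_compatible_metric)
  then have "openin (top_of_set C) (C \<inter> B)"
    by (rule openin_open_Int)
  moreover have "a \<in> C \<inter> B"
    using a \<delta> by (simp add: B_def)
  moreover have "(f ^^ n) y \<in> S" if "x \<in> C \<inter> B" "y \<in> C \<inter> B" "(f ^^ n) x \<in> S" for x y
    using iff[of x] iff[of y] that by (simp add: B_def)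
  ultimately show "\<exists>T. openin (top_of_set C) T \<and> a \<in> T \<and>
      (\<forall>x\<in>T. \<forall>y\<in>T. (f ^^ n) x \<in> S \<longrightarrow> (f ^^ n) y \<in> S)"
    by (intro exI[of _ "C \<inter> B"] conjI ballI impI)
qed


section \<open>Closed unstably saturated sets\<close>

text \<open>
  The only consequence of isometric holonomies that is used: a stable segment \<open>y x\<close> of size \<open>r\<close> can be
  slid along the unstable set of \<open>y\<close> without changing its length. A single \<open>r\<close> works at all points.
\<close>
definition stable_transport :: "real \<Rightarrow> bool" where
  "stable_transport r \<longleftrightarrow>
     (\<forall>y x y'. x \<in> Ws r y \<longrightarrow> y' \<in> Wu r y \<longrightarrow> (\<exists>x'. x' \<in> Ws \<eta> y' \<and> x' \<in> Wu \<eta> x \<and> d y' x' = d y x))"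

text \<open>
  The transported segment has the same length as the original, and its end is still in \<open>J\<close> because
  that end moves inside an unstable set. The constant \<open>c\<close> is therefore preserved exactly, which allows
  the argument to be repeated along unstable sets without loss.
\<close>
lemma stable_neighbourhood_saturated:
  assumes r: "stable_transport r" "c \<le> r"
    and J: "\<And>x y. x \<in> J \<Longrightarrow> y \<in> Wu \<eta> x \<Longrightarrow> y \<in> J"
    and y: "y \<in> (\<Union>x\<in>J. Ws c x)" "y' \<in> Wu r y"
  shows "y' \<in> (\<Union>x\<in>J. Ws c x)"
proof -
  from y(1) obtain x where x: "x \<in> J" "x \<in> Ws c y"
    using Ws_sym by blast
  then obtain x' where x': "x' \<in> Ws \<eta> y'" "x' \<in> Wu \<eta> x" "d y' x' = d y x"
    using r y(2) Ws_mono unfolding stable_transport_def by metis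
  then have "x' \<in> Ws c y'"
    using Ws_dist[OF x(2)] by (auto intro: Ws_shrink)
  then show ?thesis
    using J[OF x(1) x'(2)] by (intro UN_I[of x']) (simp_all add: Ws_sym[of y' c x'])
qed

text \<open>
  The backward orbit of \<open>y\<close> returns near a point \<open>p\<close>, and through the unstable set of \<open>p\<close> each return
  time compares \<open>y\<close> with the forward orbit of \<open>p\<close>. One return shows that this orbit is stably close to
  \<open>J\<close>, and from then on its distance to \<open>J\<close> decays; the later returns carry this back to \<open>y\<close>.
\<close>
lemma saturated_closed_absorbs_neighbourhood:
  assumes lc: "locally connected (UNIV :: 'a set)"
    and r: "stable_transport r" "0 < r" "r \<le> \<eta>"
    and J: "closed J" "\<And>x. x \<in> J \<Longrightarrow> f x \<in> J" "\<And>x y. x \<in> J \<Longrightarrow> y \<in> Wu \<eta> x \<Longrightarrow> y \<in> J"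
    and x: "x \<in> J" and y: "y \<in> Ws (r / 2) x"
  shows "y \<in> J"
proof -
  define N where "N c = (\<Union>x\<in>J. Ws c x)" for c
  have N_sat: "y' \<in> N c" if "c \<le> r" "y \<in> N c" "y' \<in> Wu r y" for c y y'
    using stable_neighbourhood_saturated[where J = J, OF r(1) that(1) J(3)] that(2,3)
    unfolding N_def by simp
  have J_pow: "(f ^^ n) x \<in> J" if "x \<in> J" for n x
    by (induction n) (use that J(2) in auto)
  have N_pow: "(f ^^ n) y \<in> N (c / \<kappa> ^ n)" if "y \<in> N c" "c \<le> r" for n c y
  proof -
    obtain x where x: "x \<in> J" "y \<in> Ws c x"
      using \<open>y \<in> N c\<close> by (auto simp: N_def)
    show ?thesis
      unfolding N_def
      using J_pow[OF x(1)] funpow_Ws[OF x(2)] that(2) r(3) by (intro UN_I) simp_all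
  qed
  obtain p where p: "\<And>e N. e > 0 \<Longrightarrow> \<exists>n\<ge>N. d ((inv f ^^ n) y) p < e"
    using exists_recurrent_limit[of "\<lambda>n. (inv f ^^ n) y"] by blast
  obtain \<tau>0 where \<tau>0: "\<tau>0 > 0"
    "\<And>z. z \<in> Wu \<tau>0 p \<Longrightarrow> \<exists>C. connected C \<and> p \<in> C \<and> z \<in> C \<and> C \<subseteq> Wu (\<eta>/2) p"
    using small_unstable_connected[OF lc, of "\<eta>/2" p] \<eta>_pos by fastforce
  define \<tau> where "\<tau> = min \<tau>0 (r / 2)"
  have \<tau>: "\<tau> > 0" "\<tau> \<le> r / 2" "\<tau> \<le> \<tau>0"
    using \<tau>0 r by (auto simp: \<tau>_def)
  obtain \<delta> where \<delta>: "\<delta> > 0" "\<And>x y. d x y < \<delta> \<Longrightarrow> \<exists>z. z \<in> Ws \<tau> x \<and> z \<in> Wu \<tau> y"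
    using local_product[OF \<tau>(1)] by blast
  \<comment> \<open>At a return time the points \<open>z\<close> and \<open>p\<close> lie in a common connected piece of the unstable set of \<open>p\<close>.\<close>
  have return: "\<exists>z. (f ^^ n) z \<in> Ws (\<tau> / \<kappa> ^ n) y \<and>
      (\<forall>c\<le>r. (f ^^ n) z \<in> N c \<longleftrightarrow> (f ^^ n) p \<in> N c)"
    if n: "d ((inv f ^^ n) y) p < \<delta>" for n
  proof -
    obtain z where z: "z \<in> Ws \<tau> ((inv f ^^ n) y)" "z \<in> Wu \<tau> p"
      using \<delta>(2)[OF n] by blast
    have "(f ^^ n) z \<in> Ws (\<tau> / \<kappa> ^ n) y"
      using funpow_Ws[OF z(1), of n] \<tau> r pow_inv_pow[of n n y] by simp
    moreover obtain C where C: "connected C" "p \<in> C" "z \<in> C" "C \<subseteq> Wu (\<eta>/2) p"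
      using \<tau>0(2)[OF Wu_mono[OF z(2) \<tau>(3)]] by blast
    have "(f ^^ n) b \<in> N c" if "c \<le> r" "a \<in> C" "b \<in> C" "(f ^^ n) a \<in> N c" for a b c
      using funpow_connected_stays_in_saturated[OF C(1,4) _ r(2) N_sat[OF that(1)] that(2-4)]
      by simp
    ultimately show ?thesis
      using C(2,3) by blast
  qed
  obtain m where m: "d ((inv f ^^ m) y) p < \<delta>"
    using p[OF \<delta>(1)] by blast
  obtain z where z: "(f ^^ m) z \<in> Ws (\<tau> / \<kappa> ^ m) y"
    "\<And>c. c \<le> r \<Longrightarrow> (f ^^ m) z \<in> N c \<longleftrightarrow> (f ^^ m) p \<in> N c"
    using return[OF m] by blast
  \<comment> \<open>Half of \<open>r\<close> is spent on the distance from \<open>x\<close> to \<open>y\<close>, and half on the distance from \<open>y\<close> to \<open>f\<^sup>m z\<close>.\<close>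
  have "\<tau> / \<kappa> ^ m \<le> r / 2"
    using divide_\<kappa>_pow_le[of \<tau> m] \<tau> by linarith
  then have "(f ^^ m) z \<in> Ws (r / 2 + r / 2) x"
    using z(1) y by (meson Ws_mono Ws_trans)
  then have "(f ^^ m) z \<in> N r"
    using x by (auto simp: N_def)
  then have p_m: "(f ^^ m) p \<in> N r"
    using z(2)[of r] by simp
  have "\<exists>q\<in>J. d y q < e" if e: "e > 0" for e
  proof -
    have "e / 2 > 0" using e by simp
    then obtain K where K: "\<And>n. n \<ge> K \<Longrightarrow> r / \<kappa> ^ n < e / 2"
      using eventually_small[of "e / 2" r] by blast
    obtain n where n: "n \<ge> m + K" "d ((inv f ^^ n) y) p < \<delta>"
      using p[OF \<delta>(1)] by blast
    define c where "c = r / \<kappa> ^ (n - m)"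
    have c: "c < e / 2" "c \<le> r"
      using K[of "n - m"] n(1) divide_\<kappa>_pow_le[of r "n - m"] r by (auto simp: c_def)
    have "(f ^^ (n - m)) ((f ^^ m) p) \<in> N c"
      unfolding c_def using N_pow[OF p_m] by simp
    then have "(f ^^ n) p \<in> N c"
      using n(1) by (simp add: funpow_funpow)
    then obtain w where w: "w \<in> Ws (\<tau> / \<kappa> ^ n) y" "w \<in> N c"
      using return[OF n(2)] c(2) by blast
    then obtain q where q: "q \<in> J" "w \<in> Ws c q"
      by (auto simp: N_def)
    have "\<tau> / \<kappa> ^ n \<le> r / \<kappa> ^ n"
      using \<tau> r \<kappa>_gt_1 by (intro divide_right_mono) auto
    then have "d y w < e / 2"
      using Ws_dist[OF w(1)] K[of n] n(1) by linarith
    moreover have "d w q < e / 2"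
      using Ws_dist[OF q(2)] c(1) by (simp add: commute)
    ultimately have "d y q < e"
      using triangle[of y w q] by simp
    with q(1) show ?thesis ..
  qed
  with J(1)[unfolded closed_iff_compatible_metric[OF compatible]] show ?thesis
    by simp
qed

text \<open>
  A point near \<open>J\<close> is reached from \<open>J\<close> by a short unstable step followed by a short stable one; the
  first stays in \<open>J\<close> by saturation and the second by absorption, so \<open>J\<close> is open.
\<close>
lemma saturated_closed_eq_UNIV:
  assumes "connected (UNIV :: 'a set)" and lc: "locally connected (UNIV :: 'a set)"
    and r: "stable_transport r" "0 < r" "r \<le> \<eta>"
    and J: "closed J" "\<And>x. x \<in> J \<Longrightarrow> f x \<in> J" "\<And>x y. x \<in> J \<Longrightarrow> y \<in> Wu \<eta> x \<Longrightarrow> y \<in> J"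
    and "J \<noteq> {}"
  shows "J = UNIV"
proof -
  have "r / 2 > 0" using r by simp
  then obtain \<delta> where \<delta>: "\<delta> > 0" "\<And>x y. d x y < \<delta> \<Longrightarrow> \<exists>z. z \<in> Ws (r/2) x \<and> z \<in> Wu (r/2) y"
    using local_product by blast
  have "y \<in> J" if x: "x \<in> J" and y: "d x y < \<delta>" for x y
  proof -
    obtain z where z: "z \<in> Ws (r/2) y" "z \<in> Wu (r/2) x"
      using \<delta>(2)[of y x] y commute by metis
    then have "z \<in> J"
      using J(3)[OF x] Wu_mono[of z "r/2" x \<eta>] r by simp
    moreover have "y \<in> Ws (r/2) z"
      using z(1) by (simp add: Ws_sym[of y])
    ultimately show ?thesis
      using saturated_closed_absorbs_neighbourhood[OF lc r J(1) _ _ \<open>z \<in> J\<close>] J(2,3) by blast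
  qed
  then have "open J"
    unfolding open_iff_compatible_metric[OF compatible] using \<delta>(1) by blast
  then show ?thesis
    using assms(1) J(1) \<open>J \<noteq> {}\<close> by (auto simp: connected_clopen)
qed


section \<open>Prolongational limit sets\<close>

definition prolongational_limit :: "'a \<Rightarrow> 'a set" where
  "prolongational_limit x = {y. \<forall>e>0. \<forall>N. \<exists>n\<ge>N. \<exists>u. d x u < e \<and> d y ((f ^^ n) u) < e}"

lemma prolongational_limitD:
  assumes "y \<in> prolongational_limit x" "e > 0"
  obtains n u where "n \<ge> N" "d x u < e" "d y ((f ^^ n) u) < e"
  using assms unfolding prolongational_limit_def by blast

lemma closed_prolongational_limit: "closed (prolongational_limit x)"
  unfolding closed_iff_compatible_metric[OF compatible]
proof (intro allI impI)
  fix y assume y: "\<forall>r>0. \<exists>z\<in>prolongational_limit x. d y z < r"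
  show "y \<in> prolongational_limit x"
    unfolding prolongational_limit_def
  proof (intro CollectI allI impI)
    fix e :: real and N assume "e > 0"
    then have e: "e / 2 > 0" by simp
    obtain z where z: "z \<in> prolongational_limit x" "d y z < e / 2"
      using y e by blast
    obtain n u where "n \<ge> N" "d x u < e/2" "d z ((f ^^ n) u) < e/2"
      using prolongational_limitD[OF z(1) e] .
    moreover from this have "d y ((f ^^ n) u) < e"
      using triangle[of y z "(f ^^ n) u"] z(2) by simp
    ultimately show "\<exists>n\<ge>N. \<exists>u. d x u < e \<and> d y ((f ^^ n) u) < e"
      using \<open>e > 0\<close> by (intro exI[of _ n]) (auto intro!: exI[of _ u])
  qed
qed

lemma prolongational_limit_nonempty: "prolongational_limit x \<noteq> {}"
proof -
  obtain p where p: "\<And>e N. e > 0 \<Longrightarrow> \<exists>n\<ge>N. d ((f ^^ n) x) p < e"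
    using exists_recurrent_limit[of "\<lambda>n. (f ^^ n) x"] by blast
  have "p \<in> prolongational_limit x"
    unfolding prolongational_limit_def
  proof (intro CollectI allI impI)
    fix e :: real and N assume e: "e > 0"
    obtain n where "n \<ge> N" "d ((f ^^ n) x) p < e"
      using p[OF e] by blast
    then show "\<exists>n\<ge>N. \<exists>u. d x u < e \<and> d p ((f ^^ n) u) < e"
      using e by (intro exI[of _ n]) (auto intro!: exI[of _ x] simp: commute)
  qed
  then show ?thesis by blast
qed

lemma prolongational_limit_invariant:
  assumes y: "y \<in> prolongational_limit x"
  shows "f y \<in> prolongational_limit x" "inv f y \<in> prolongational_limit x"
proof -
  have aux: "\<exists>n\<ge>N. \<exists>u. d x u < e \<and> d y ((f ^^ n) u) \<le> \<eta> \<and> \<kappa> * d y ((f ^^ n) u) < e"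
    if e: "e > 0" for e :: real and N
  proof -
    have "min e (min \<eta> (e / \<kappa>)) > 0"
      using e \<eta>_pos \<kappa>_gt_1 by simp
    from prolongational_limitD[OF y this] obtain n u where
      "n \<ge> N" "d x u < min e (min \<eta> (e / \<kappa>))" "d y ((f ^^ n) u) < min e (min \<eta> (e / \<kappa>))" .
    then show ?thesis
      using \<kappa>_gt_1 by (intro exI[of _ n]) (auto intro!: exI[of _ u] simp: less_divide_eq mult.commute)
  qed
  show "f y \<in> prolongational_limit x"
    unfolding prolongational_limit_def
  proof (intro CollectI allI impI)
    fix e :: real and N assume e: "e > 0"
    obtain n u where u: "n \<ge> N" "d x u < e" "d y ((f ^^ n) u) \<le> \<eta>" "\<kappa> * d y ((f ^^ n) u) < e"
      using aux[OF e] by blast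
    have "d (f y) ((f ^^ Suc n) u) < e"
      using f_lipschitz[OF u(3)] u(4) by simp
    then show "\<exists>n\<ge>N. \<exists>u. d x u < e \<and> d (f y) ((f ^^ n) u) < e"
      using u by (intro exI[of _ "Suc n"]) (auto intro!: exI[of _ u])
  qed
  show "inv f y \<in> prolongational_limit x"
    unfolding prolongational_limit_def
  proof (intro CollectI allI impI)
    fix e :: real and N assume e: "e > 0"
    obtain n u where u: "n \<ge> Suc N" "d x u < e" "d y ((f ^^ n) u) \<le> \<eta>" "\<kappa> * d y ((f ^^ n) u) < e"
      using aux[OF e] by blast
    then obtain k where k: "n = Suc k" "k \<ge> N"
      by (cases n) auto
    have "d (inv f y) ((f ^^ k) u) < e"
      using inv_f_lipschitz[OF u(3)] u(4) by (simp add: k)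
    then show "\<exists>n\<ge>N. \<exists>u. d x u < e \<and> d (inv f y) ((f ^^ n) u) < e"
      using u k by (intro exI[of _ k]) (auto intro!: exI[of _ u])
  qed
qed

text \<open>
  Pull \<open>y\<close> and \<open>z\<close> back by \<open>f\<^sup>m\<close> until they are very close. The pulled back \<open>y\<close> is nearly of the form
  \<open>f\<^sup>n u\<close> with \<open>u\<close> near \<open>x\<close>, and canonical coordinates give a point \<open>w\<close> whose past shadows \<open>f\<^sup>n u\<close> and whose
  future shadows the pulled back \<open>z\<close>. So \<open>f\<^sup>-\<^sup>n w\<close> is near \<open>x\<close> and reaches the vicinity of \<open>z\<close> after
  \<open>m + n\<close> steps.
\<close>
lemma prolongational_limit_saturated:
  assumes y: "y \<in> prolongational_limit x" and z: "z \<in> Wu \<eta> y"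
  shows "z \<in> prolongational_limit x"
  unfolding prolongational_limit_def
proof (intro CollectI allI impI)
  fix e :: real and N assume "e > 0"
  then have e: "e / 2 > 0" by simp
  obtain \<delta> where \<delta>: "\<delta> > 0" "\<And>x y. d x y < \<delta> \<Longrightarrow> \<exists>w. w \<in> Ws (e/2) x \<and> w \<in> Wu (e/2) y"
    using local_product[OF e] by blast
  obtain m where m: "\<eta> / \<kappa> ^ m < \<delta> / 2"
    using eventually_small[of "\<delta>/2" \<eta>] \<delta>(1) by auto
  let ?y = "(inv f ^^ m) y" and ?z = "(inv f ^^ m) z"
  have near: "d ?y ?z < \<delta> / 2"
    using Wu_dist[OF inv_funpow_Wu[OF z order_refl, of m]] m by linarith
  have "?y \<in> prolongational_limit x"
    by (induction m) (use y prolongational_limit_invariant in auto)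
  moreover have "min (e/2) (\<delta>/2) > 0"
    using e \<delta>(1) by simp
  ultimately obtain n u where
    u: "n \<ge> N" "d x u < min (e/2) (\<delta>/2)" "d ?y ((f ^^ n) u) < min (e/2) (\<delta>/2)"
    using prolongational_limitD by blast
  have "d ?z ((f ^^ n) u) < \<delta>"
    using triangle[of ?z ?y "(f ^^ n) u"] near u(3) commute[of ?z ?y] by simp
  then obtain w where w: "w \<in> Ws (e/2) ?z" "w \<in> Wu (e/2) ((f ^^ n) u)"
    using \<delta>(2) by blast
  let ?v = "(inv f ^^ n) w"
  have "d u ?v \<le> e/2"
    using w(2) inv_pow_pow[of n n u] by (auto simp: Wu_iff dest!: spec[of _ n])
  then have "d x ?v < e"
    using triangle[of x u ?v] u(2) by simp
  moreover have "(f ^^ (m + n)) ?v = (f ^^ m) w"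
    using pow_inv_pow[of n n w] by (simp add: funpow_add)
  moreover have "d z ((f ^^ m) w) \<le> e/2"
    using w(1) pow_inv_pow[of m m z] by (auto simp: Ws_iff dest!: spec[of _ m])
  ultimately show "\<exists>n\<ge>N. \<exists>u. d x u < e \<and> d z ((f ^^ n) u) < e"
    using u(1) e by (intro exI[of _ "m + n"] conjI exI[of _ ?v]) auto
qed

theorem stable_transport_imp_transitive:
  assumes "connected (UNIV :: 'a set)" "locally connected (UNIV :: 'a set)"
    and "stable_transport r" "0 < r" "r \<le> \<eta>"
  shows "topologically_transitive f"
  unfolding topologically_transitive_def
proof (intro allI impI, elim conjE)
  fix U V :: "'a set"
  assume U: "open U" "U \<noteq> {}" and V: "open V" "V \<noteq> {}"
  obtain x y where x: "x \<in> U" and y: "y \<in> V"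
    using U V by blast
  obtain s where s: "s > 0" "\<And>z. d x z < s \<Longrightarrow> z \<in> U"
    using U(1) x open_iff_compatible_metric[OF compatible] by blast
  obtain t where t: "t > 0" "\<And>z. d y z < t \<Longrightarrow> z \<in> V"
    using V(1) y open_iff_compatible_metric[OF compatible] by blast
  have "prolongational_limit x = UNIV"
    using assms
    by (intro saturated_closed_eq_UNIV closed_prolongational_limit prolongational_limit_nonempty)
      (auto intro: prolongational_limit_invariant prolongational_limit_saturated)
  moreover have "min s t > 0"
    using s t by simp
  ultimately obtain n u where "d x u < min s t" "d y ((f ^^ n) u) < min s t"
    using prolongational_limitD[of y x "min s t"] by blast
  then have "u \<in> U" "(f ^^ n) u \<in> V"
    using s t by auto
  then show "\<exists>n. (f ^^ n) ` U \<inter> V \<noteq> {}"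
    by blast
qed


section \<open>Transport from isometric holonomies\<close>

context
  fixes \<epsilon> :: real
  assumes \<epsilon>: "expansive_constant f d (2 * \<epsilon>)"
begin

lemma \<epsilon>_pos: "\<epsilon> > 0"
  using \<epsilon> by (simp add: expansive_constant_def)

lemma bracket_unique:
  assumes "z \<in> Ws \<epsilon> x" "z \<in> Wu \<epsilon> y" "w \<in> Ws \<epsilon> x" "w \<in> Wu \<epsilon> y"
  shows "z = w"
proof -
  have "w \<in> Ws (\<epsilon> + \<epsilon>) z" "w \<in> Wu (\<epsilon> + \<epsilon>) z"
    using assms by (meson Ws_trans Wu_trans Ws_sym Wu_sym)+
  then show ?thesis
    using Ws_Wu_unique[OF \<epsilon>] by simp
qed

lemma bracket_eqI: "z \<in> Ws \<epsilon> x \<Longrightarrow> z \<in> Wu \<epsilon> y \<Longrightarrow> bracket f d \<epsilon> x y = z"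
  unfolding bracket_def using bracket_unique by (intro the_equality) auto

lemma bracket_definedI: "z \<in> Ws \<epsilon> x \<Longrightarrow> z \<in> Wu \<epsilon> y \<Longrightarrow> bracket_defined f d \<epsilon> x y"
  unfolding bracket_defined_def using bracket_unique by blast

lemma bracket_mem:
  assumes "bracket_defined f d \<epsilon> x y"
  shows "bracket f d \<epsilon> x y \<in> Ws \<epsilon> x" "bracket f d \<epsilon> x y \<in> Wu \<epsilon> y"
  using theI'[OF assms[unfolded bracket_defined_def]] unfolding bracket_def by auto

text \<open>
  Box brackets can be formed at any prescribed small scale \<open>s\<close>, uniformly in the centre. Uniqueness at
  scale \<open>\<epsilon>\<close> identifies the bracket with the point found at the smaller scale. The scale \<open>s\<close> is needed
  because \<open>\<epsilon>\<close> may exceed the range \<open>\<eta>\<close> of the expansion law.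
\<close>
lemma uniformly_admissible:
  assumes s: "0 < s" "s \<le> \<epsilon>"
  obtains r where "0 < r" "r \<le> s" "\<And>q. admissible_box f d \<epsilon> q r"
    "\<And>q x y. x \<in> Ws r q \<Longrightarrow> y \<in> Wu r q \<Longrightarrow>
       bracket f d \<epsilon> y x \<in> Ws s y \<and> bracket f d \<epsilon> y x \<in> Wu s x"
proof -
  obtain \<delta> where \<delta>: "\<delta> > 0" "\<And>x y. d x y < \<delta> \<Longrightarrow> \<exists>z. z \<in> Ws \<epsilon> x \<and> z \<in> Wu \<epsilon> y"
    using local_product[OF \<epsilon>_pos] by blast
  \<comment> \<open>Points of the box are within \<open>r + t \<le> \<delta> / 4\<close> of its centre, hence close enough to each other for a bracket.\<close>
  define t where "t = min s (\<delta> / 8)"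
  have t: "t > 0" "t \<le> s" "t \<le> \<epsilon>" "8 * t \<le> \<delta>"
    using s \<delta>(1) by (auto simp: t_def)
  obtain \<delta>' where \<delta>': "\<delta>' > 0" "\<And>x y. d x y < \<delta>' \<Longrightarrow> \<exists>z. z \<in> Ws t x \<and> z \<in> Wu t y"
    using local_product[OF t(1)] by blast
  define r where "r = min t (\<delta>' / 4)"
  have r: "0 < r" "r \<le> t" "4 * r \<le> \<delta>'"
    using t \<delta>'(1) by (auto simp: r_def)
  have br: "bracket_defined f d \<epsilon> y x \<and> bracket f d \<epsilon> y x \<in> Ws t y \<and> bracket f d \<epsilon> y x \<in> Wu t x"
    if x: "x \<in> Ws r q" and y: "y \<in> Wu r q" for x y q
  proof -
    have "d y x < \<delta>'"
      using triangle[of y q x] Ws_dist[OF x] Wu_dist[OF y] commute[of y q] r by simp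
    then obtain z where z: "z \<in> Ws t y" "z \<in> Wu t x"
      using \<delta>'(2) by blast
    then have "z \<in> Ws \<epsilon> y" "z \<in> Wu \<epsilon> x"
      using t(3) by (auto intro: Ws_mono Wu_mono)
    then show ?thesis
      using z bracket_eqI bracket_definedI by metis
  qed
  have box: "d q a < \<delta> / 2" if a: "a \<in> product_box f d \<epsilon> q r" for a q
  proof -
    obtain x y where xy: "x \<in> Ws r q" "y \<in> Wu r q" "a = bracket f d \<epsilon> y x"
      using a unfolding product_box_def by blast
    then have "a \<in> Wu t x"
      using br by blast
    then show ?thesis
      using triangle[of q x a] Ws_dist[OF xy(1)] Wu_dist[of a t x] r t by simp
  qed
  have "admissible_box f d \<epsilon> q r" for q
    unfolding admissible_box_def
  proof (intro conjI ballI)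
    show "0 < r" "r \<le> \<epsilon>"
      using r t by auto
    show "bracket_defined f d \<epsilon> y x" if "x \<in> Ws r q" "y \<in> Wu r q" for x y
      using br that by blast
    fix a b assume ab: "a \<in> product_box f d \<epsilon> q r" "b \<in> product_box f d \<epsilon> q r"
    have "d a b < \<delta>"
      using triangle[of a q b] box[OF ab(1)] box[OF ab(2)] commute[of a q] by simp
    then show "bracket_defined f d \<epsilon> a b"
      using \<delta>(2) bracket_definedI by blast
  qed
  moreover have "bracket f d \<epsilon> y x \<in> Ws s y \<and> bracket f d \<epsilon> y x \<in> Wu s x"
    if "x \<in> Ws r q" "y \<in> Wu r q" for x y q
    using br[OF that] t(2) by (auto intro: Ws_mono Wu_mono)
  ultimately show ?thesis
    using that[of r] r t by auto
qed

text \<open>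
  Holonomy between the stable plaques of \<open>y\<close> and \<open>y'\<close> keeps the stable coordinate \<open>x\<close>. It is well defined
  because a point of the box determines that coordinate: two candidates lie in the stable set of size
  \<open>r \<le> \<epsilon>\<close> of the centre and in the unstable set of size \<open>\<epsilon>\<close> of the same point.
\<close>
lemma stable_holonomy_eq_bracket:
  assumes adm: "admissible_box f d \<epsilon> q r"
    and x: "x \<in> Ws r q" and y: "y \<in> Wu r q" and y': "y' \<in> Wu r q"
  shows "holonomy (unstable_plaques f d \<epsilon> q r) {bracket f d \<epsilon> y' x | x. x \<in> Ws r q}
           (bracket f d \<epsilon> y x) = bracket f d \<epsilon> y' x"
proof -
  have def: "bracket_defined f d \<epsilon> y x" if "x \<in> Ws r q" "y \<in> Wu r q" for x y
    using adm that unfolding admissible_box_def by blast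
  have r\<epsilon>: "r \<le> \<epsilon>"
    using adm by (simp add: admissible_box_def)
  have foot: "x1 = x2"
    if "x1 \<in> Ws r q" "x2 \<in> Ws r q" "y1 \<in> Wu r q" "y2 \<in> Wu r q"
      "bracket f d \<epsilon> y1 x1 = bracket f d \<epsilon> y2 x2" for x1 x2 y1 y2
  proof -
    have "x2 \<in> Ws (r + r) x1"
      using that(1,2) by (meson Ws_sym Ws_trans)
    moreover have "x2 \<in> Wu (\<epsilon> + \<epsilon>) x1"
      using bracket_mem(2)[OF def[OF that(1,3)]] bracket_mem(2)[OF def[OF that(2,4)]] that(5)
      by (metis Wu_sym Wu_trans)
    ultimately show ?thesis
      using r\<epsilon> Ws_Wu_unique[OF \<epsilon>, of x2 x1] Ws_mono[of x2 "r + r" x1 "2 * \<epsilon>"] by simp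
  qed
  show ?thesis
    unfolding holonomy_def
  proof (rule the_equality)
    have "{bracket f d \<epsilon> y x | y. y \<in> Wu r q} \<in> unstable_plaques f d \<epsilon> q r"
      using x by (auto simp: unstable_plaques_def)
    moreover have "bracket f d \<epsilon> y x \<in> {bracket f d \<epsilon> y x | y. y \<in> Wu r q}"
      "bracket f d \<epsilon> y' x \<in> {bracket f d \<epsilon> y x | y. y \<in> Wu r q}"
      "bracket f d \<epsilon> y' x \<in> {bracket f d \<epsilon> y' x | x. x \<in> Ws r q}"
      using x y y' by blast+
    ultimately show "bracket f d \<epsilon> y' x \<in> {bracket f d \<epsilon> y' x | x. x \<in> Ws r q} \<and>
        (\<exists>T\<in>unstable_plaques f d \<epsilon> q r. bracket f d \<epsilon> y x \<in> T \<and> bracket f d \<epsilon> y' x \<in> T)"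
      by (intro conjI bexI)
  next
    fix b
    assume b: "b \<in> {bracket f d \<epsilon> y' x | x. x \<in> Ws r q} \<and>
        (\<exists>T\<in>unstable_plaques f d \<epsilon> q r. bracket f d \<epsilon> y x \<in> T \<and> b \<in> T)"
    then obtain T where T: "T \<in> unstable_plaques f d \<epsilon> q r" "bracket f d \<epsilon> y x \<in> T" "b \<in> T"
      by metis
    obtain x1 where x1: "x1 \<in> Ws r q" "b = bracket f d \<epsilon> y' x1"
      using b by auto
    obtain x2 where x2: "x2 \<in> Ws r q" "T = {bracket f d \<epsilon> y x2 | y. y \<in> Wu r q}"
      using T(1) unfolding unstable_plaques_def by auto
    obtain y2 where y2: "y2 \<in> Wu r q" "bracket f d \<epsilon> y x = bracket f d \<epsilon> y2 x2"
      using T(2) x2(2) by auto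
    obtain y3 where y3: "y3 \<in> Wu r q" "b = bracket f d \<epsilon> y3 x2"
      using T(3) x2(2) by auto
    have "x = x2"
      using foot[OF x x2(1) y y2] .
    moreover have "x1 = x2"
      using foot[OF x1(1) x2(1) y' y3(1)] x1(2) y3(2) by simp
    ultimately show "b = bracket f d \<epsilon> y' x"
      using x1(2) by simp
  qed
qed

text \<open>
  In a box centred at \<open>y\<close>, the stable plaque of \<open>y\<close> is its local stable set, so holonomy to the plaque
  of \<open>y'\<close> sends the pair \<open>y\<close>, \<open>x\<close> to \<open>y'\<close>, \<open>[y', x]\<close>.
\<close>
lemma isometric_holonomies_imp_stable_transport:
  assumes iso: "isometric_holonomies f d \<epsilon>"
  obtains r where "0 < r" "r \<le> \<eta>" "stable_transport r"
proof -
  define s where "s = min \<epsilon> \<eta>"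
  have s: "0 < s" "s \<le> \<epsilon>" "s \<le> \<eta>"
    using \<epsilon>_pos \<eta>_pos by (auto simp: s_def)
  obtain r where r: "0 < r" "r \<le> s" and adm: "\<And>q. admissible_box f d \<epsilon> q r"
    and br: "\<And>q x y. x \<in> Ws r q \<Longrightarrow> y \<in> Wu r q \<Longrightarrow>
       bracket f d \<epsilon> y x \<in> Ws s y \<and> bracket f d \<epsilon> y x \<in> Wu s x"
    using uniformly_admissible[OF s(1,2)] by blast
  have "stable_transport r"
    unfolding stable_transport_def
  proof (intro allI impI)
    fix y x y' assume x: "x \<in> Ws r y" and y': "y' \<in> Wu r y"
    let ?P = "\<lambda>y'. {bracket f d \<epsilon> y' x | x. x \<in> Ws r y}"
    let ?h = "holonomy (unstable_plaques f d \<epsilon> y r) (?P y')"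
    have y: "y \<in> Ws r y" "y \<in> Wu r y"
      using r by (auto intro: Ws_refl Wu_refl)
    have "?P y \<in> stable_plaques f d \<epsilon> y r" "?P y' \<in> stable_plaques f d \<epsilon> y r"
      using y(2) y' by (auto simp: stable_plaques_def)
    then have "preserves_metric_on d (?P y) ?h"
      using iso adm unfolding isometric_holonomies_def by blast
    moreover have "bracket f d \<epsilon> y y \<in> ?P y" "bracket f d \<epsilon> y x \<in> ?P y"
      using x y by blast+
    ultimately have "d (?h (bracket f d \<epsilon> y y)) (?h (bracket f d \<epsilon> y x)) =
        d (bracket f d \<epsilon> y y) (bracket f d \<epsilon> y x)"
      unfolding preserves_metric_on_def by blast
    moreover have "?h (bracket f d \<epsilon> y y) = bracket f d \<epsilon> y' y"
        "?h (bracket f d \<epsilon> y x) = bracket f d \<epsilon> y' x"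
      using stable_holonomy_eq_bracket[OF adm] x y y' by auto
    moreover have "bracket f d \<epsilon> y y = y" "bracket f d \<epsilon> y x = x" "bracket f d \<epsilon> y' y = y'"
      using x y y' r s
      by (auto intro!: bracket_eqI Ws_refl Wu_refl intro: Ws_mono Wu_mono Wu_mono[of _ r]
          simp: Wu_sym[of y' r])
    ultimately have "d y' (bracket f d \<epsilon> y' x) = d y x"
      by simp
    then show "\<exists>x'. x' \<in> Ws \<eta> y' \<and> x' \<in> Wu \<eta> x \<and> d y' x' = d y x"
      using br[OF x y'] s(3) by (blast intro: Ws_mono Wu_mono)
  qed
  then show ?thesis
    using that r s by auto
qed

end

end


section \<open>Transitivity\<close>

theorem theorem4p6:
  fixes f :: "'a::metric_space \<Rightarrow> 'a"
    and d :: "'a \<Rightarrow> 'a \<Rightarrow> real"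
    and \<epsilon> :: real
  assumes "peano_continuum (UNIV :: 'a set)"
    and "homeomorphism UNIV UNIV f (inv f)"
    and "expansive f dist"
    and "canonical_coordinates f dist"
    and "self_similar_metric f d"
    and "expansive_constant f d (2 * \<epsilon>)"
    and "isometric_holonomies f d \<epsilon>"
  shows "topologically_transitive f"
proof -
  have M: "compact (UNIV :: 'a set)" "connected (UNIV :: 'a set)" "locally connected (UNIV :: 'a set)"
    using assms(1) by (simp_all add: peano_continuum_def)
  have d: "compatible_metric d"
    using assms(5) by (simp add: self_similar_metric_def)
  obtain \<eta> \<kappa> where "expansive_constant f d \<eta>" "\<kappa> > 1"
    "\<And>p q. d p q \<le> \<eta> \<Longrightarrow> max (d (f p) (f q)) (d (inv f p) (inv f q)) = \<kappa> * d p q"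
    using assms(5) unfolding self_similar_metric_def by blast
  then interpret self_similar_system f d \<eta> \<kappa>
    using M(1) assms(2) d
      canonical_coordinates_change_metric[OF M(1) compatible_metric_dist d assms(4)]
    by unfold_locales auto
  obtain r where "0 < r" "r \<le> \<eta>" "stable_transport r"
    using isometric_holonomies_imp_stable_transport[OF assms(6,7)] .
  then show ?thesis
    using stable_transport_imp_transitive[OF M(2,3)] by blast
qed

end
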